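(* Let $G=(V,E)$ be any finite simple undirected graph with $V\neq\emptyset$. Then: (i) for every coalition game $\mathcal G$ over the interaction graph $G$, $\dfrac{\kappa(\mathcal G)}{\rho(\mathcal G)}\le \tau(G)$; (ii) there exists a coalition game $\mathcal G$ over the interaction graph $G$ with $\dfrac{\kappa(\mathcal G)}{\rho(\mathcal G)}\ge \tau(G)$. Hence the maximum of the packing-covering ratio $\kappa(\mathcal G)/\rho(\mathcal G)$ over all coalition games on $G$ equals $\tau(G)$.
   Context: Coalition game over an interaction graph: for a finite simple undirected graph $G=(V,E)$, a coalition game $\mathcal G$ over $G$ is given by a valuation $v:2^V\to\mathbb Z_{\ge 0}$ such that $v(\emptyset)=0$, $v(S)=0$ whenever the induced subgraph $G[S]$ is disconnected, and $v$ is not identically zero. Define $\kappa^f(\mathcal G)=\min\{\sum_{i\in V}x_i : x\in\mathbb R_{\ge0}^V,\ \sum_{i\in S}x_i\ge v(S)\ \forall S\subseteq V\}$ and $\kappa(\mathcal G)$ the same minimum over $x\in\mathbb Z_{\ge 0}^V$; $\rho^f(\mathcal G)=\max\{\sum_{S\subseteq V}v(S)y_S : y\ge 0,\ \sum_{S\ni i}y_S\le 1\ \forall i\in V\}$ and $\rho(\mathcal G)$ the same maximum over $y\in\{0,1\}^{2^V}$ (i.e. the maximum of $\sum v(S)$ over families of pairwise disjoint subsets $S$). Thicket: a finite collection $\mathcal H$ of nonempty subsets of $V$ such that each member induces a connected subgraph of $G$ and any two members intersect. A hitting set of $\mathcal H$ is a vertex set meeting every member; the hitting size $\tau(\mathcal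 H)$ is the minimum cardinality of a hitting set. The thicket number $\tau(G)$ is the maximum of $\tau(\mathcal H)$ over all thickets $\mathcal H$ of $G$. *)

theory Defs
  imports Complex_Main
begin

definition simple_graph :: "'a set \<Rightarrow> ('a \<Rightarrow> 'a \<Rightarrow> bool) \<Rightarrow> bool" where
  "simple_graph V E \<longleftrightarrow> finite V \<and> (\<forall>x y. E x y \<longrightarrow> x \<in> V \<and> y \<in> V)
     \<and> (\<forall>x y. E x y \<longrightarrow> E y x) \<and> (\<forall>x. \<not> E x x)"

definition induced_connected :: "('a \<Rightarrow> 'a \<Rightarrow> bool) \<Rightarrow> 'a set \<Rightarrow> bool" where
  "induced_connected E S \<longleftrightarrow> S \<noteq> {} \<and>
     (\<forall>x\<in>S. \<forall>y\<in>S. (\<lambda>a b. E a b \<and> a \<in> S \<and> b \<in> S)\<^sup>*\<^sup>* x y)"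

text \<open>Coalition game over G, given by its valuation v (only values on subsets of V matter).\<close>
definition coalition_game :: "'a set \<Rightarrow> ('a \<Rightarrow> 'a \<Rightarrow> bool) \<Rightarrow> ('a set \<Rightarrow> nat) \<Rightarrow> bool" where
  "coalition_game V E v \<longleftrightarrow> v {} = 0
     \<and> (\<forall>S. S \<subseteq> V \<and> \<not> induced_connected E S \<longrightarrow> v S = 0)
     \<and> (\<exists>S. S \<subseteq> V \<and> v S \<noteq> 0)"

definition kappa :: "'a set \<Rightarrow> ('a set \<Rightarrow> nat) \<Rightarrow> nat" where
  "kappa V v = (LEAST k. \<exists>x :: 'a \<Rightarrow> nat.
      (\<forall>S. S \<subseteq> V \<longrightarrow> v S \<le> sum x S) \<and> sum x V = k)"

definition rho :: "'a set \<Rightarrow> ('a set \<Rightarrow> nat) \<Rightarrow> nat" where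
  "rho V v = Max {(\<Sum>S\<in>F. v S) | F. F \<subseteq> Pow V \<and> pairwise disjnt F}"

definition thicket :: "'a set \<Rightarrow> ('a \<Rightarrow> 'a \<Rightarrow> bool) \<Rightarrow> 'a set set \<Rightarrow> bool" where
  "thicket V E H \<longleftrightarrow> finite H \<and> (\<forall>A\<in>H. A \<subseteq> V \<and> A \<noteq> {} \<and> induced_connected E A)
     \<and> (\<forall>A\<in>H. \<forall>B\<in>H. A \<inter> B \<noteq> {})"

definition hitting_size :: "'a set \<Rightarrow> 'a set set \<Rightarrow> nat" where
  "hitting_size V H = (LEAST k. \<exists>X. X \<subseteq> V \<and> card X = k \<and> (\<forall>A\<in>H. X \<inter> A \<noteq> {}))"

definition thicket_number :: "'a set \<Rightarrow> ('a \<Rightarrow> 'a \<Rightarrow> bool) \<Rightarrow> nat" where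
  "thicket_number V E = Max {hitting_size V H | H. thicket V E H}"

end

theory Submission
  imports Defs
begin

text \<open>The upper bound rests on a bramble-style duality between thickets and recursive splittings of
  \<open>V\<close>: at each split the edges between distinct parts, and those leaving the set being split, are
  covered by at most \<open>k\<close> vertices. If \<open>V\<close> cannot be split into small sets (small sets being closed
  under subsets), take a minimal upward closed family \<open>\<B>\<close> of non-small sets such that \<open>V\<close> cannot be
  split into sets outside \<open>\<B>\<close>. If \<open>\<B>\<close> had two disjoint members, then two disjoint minimal members
  \<open>\<alpha>\<close>, \<open>\<beta>\<close> would be the only obstructions to two splittings, which are rerooted at \<open>\<alpha>\<close> and \<open>\<beta>\<close> and
  glued along a cheapest cut separating \<open>\<alpha>\<close> from \<open>\<beta>\<close>. So \<open>\<B>\<close> is intersecting, and its connected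
  members form a thicket that no \<open>k\<close> vertices hit.

  For \<open>k = \<tau>(G)\<close> every splitting therefore exists. Given a game, split \<open>V\<close> until the parts contain no
  coalition of positive value (or are singletons). A lowest set that still contains such a coalition
  \<open>S\<^sub>0\<close> provides \<open>k\<close> vertices such that every coalition of positive value avoiding them is disjoint
  from \<open>S\<^sub>0\<close>. Paying \<open>1\<close> to each of these vertices decreases the packing number, and one inducts.
  For the lower bound, the indicator game of an optimal thicket has packing number \<open>1\<close>, and the
  support of any cover is a hitting set.\<close>

section \<open>Splittings and brambles\<close>

text \<open>\<open>X\<close> may use vertices on both sides of \<open>P\<close>, so in a simple
  graph it covers the cut of \<open>P\<close> exactly when it covers that of
  \<open>V - P\<close>.\<close>

definition covers_cut :: "('a \<Rightarrow> 'a \<Rightarrow> bool) \<Rightarrow> 'a set \<Rightarrow> 'a set \<Rightarrow> bool" where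
  "covers_cut E X P \<longleftrightarrow> (\<forall>x y. E x y \<and> x \<in> P \<and> y \<notin> P \<longrightarrow> x \<in> X \<or> y \<in> X)"

text \<open>An edge leaving \<open>C\<close> leaves one of the parts, so \<open>X\<close> covers it
  too. Hence \<open>V - C\<close> can join the parts of a node, which is what allows a change of
  root.\<close>

inductive decomposable ::
  "'a set \<Rightarrow> ('a \<Rightarrow> 'a \<Rightarrow> bool) \<Rightarrow> nat \<Rightarrow> ('a set \<Rightarrow> bool) \<Rightarrow> 'a set \<Rightarrow> bool"
  for V E k N where
  leaf: "N C \<Longrightarrow> C \<subseteq> V \<Longrightarrow> decomposable V E k N C"
| split: "\<Union>Q = C \<Longrightarrow> pairwise disjnt Q \<Longrightarrow> X \<subseteq> V \<Longrightarrow> card X \<le> k \<Longrightarrow>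
    (\<And>P. P \<in> Q \<Longrightarrow> covers_cut E X P) \<Longrightarrow> (\<And>P. P \<in> Q \<Longrightarrow> decomposable V E k N P) \<Longrightarrow>
    decomposable V E k N C"

lemma decomposable_subset: "decomposable V E k N C \<Longrightarrow> C \<subseteq> V"
  by (induction rule: decomposable.induct) (simp, metis Union_least)

lemma decomposable_cover:
  assumes "decomposable V E k N C" and "\<not> N C"
  shows "\<exists>X. X \<subseteq> V \<and> card X \<le> k \<and> covers_cut E X C"
  using assms(1)
proof cases
  case (split Q X)
  then have "covers_cut E X C" unfolding covers_cut_def by blast
  then show ?thesis using split by blast
qed (use assms(2) in simp)

lemma decomposable_mono:
  assumes "decomposable V E k N C" and "\<And>A. A \<subseteq> V \<Longrightarrow> N A \<Longrightarrow> N' A"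
  shows "decomposable V E k N' C"
  using assms(1)
proof (induction rule: decomposable.induct)
  case (leaf C)
  then show ?case using assms(2) by (auto intro: decomposable.leaf)
next
  case (split Q C X)
  show ?case
    by (rule decomposable.split[of Q C X]) (use split in auto)
qed

section \<open>Rerooting and pushing splittings\<close>

text \<open>If the leaf \<open>\<alpha>\<close> is needed, it lies in only one part of each node,
  since parts are disjoint and \<open>\<alpha>\<close> is nonempty. Reversing the path from the root
  to this leaf turns a decomposition of \<open>V - C\<close>, hung on at the old root, into one of
  \<open>V - \<alpha>\<close>.\<close>

lemma decomposable_reroot:
  assumes G: "simple_graph V E" and "\<alpha> \<noteq> {}"
    and "decomposable V E k (\<lambda>A. N A \<or> A = \<alpha>) C"
  shows "decomposable V E k N C \<or>
    (\<alpha> \<subseteq> C \<and> (decomposable V E k N (V - C) \<longrightarrow> decomposable V E k N (V - \<alpha>)))"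
  using assms(3)
proof (induction rule: decomposable.induct)
  case (leaf C)
  then show ?case by (auto intro: decomposable.leaf)
next
  case (split Q C X)
  show ?case
  proof (cases "\<forall>P\<in>Q. decomposable V E k N P")
    case True
    then show ?thesis
      using decomposable.split[of Q C X V k E N] split by blast
  next
    case False
    then obtain P where P: "P \<in> Q" "\<not> decomposable V E k N P" by blast
    with split.IH have sub: "\<alpha> \<subseteq> P"
      and imp: "decomposable V E k N (V - P) \<longrightarrow> decomposable V E k N (V - \<alpha>)" by blast+
    have others: "decomposable V E k N P'" if "P' \<in> Q - {P}" for P'
    proof -
      have "disjnt P' P" using that P(1) split(2) by (auto simp: pairwise_def)
      then have "\<not> \<alpha> \<subseteq> P'" using sub \<open>\<alpha> \<noteq> {}\<close> by (auto simp: disjnt_def)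
      then show ?thesis using split.IH that by blast
    qed
    have QV: "\<Union>Q \<subseteq> V"
      using split(6) by (auto dest: decomposable_subset)
    \<comment> \<open>The same \<open>X\<close> splits \<open>V - P\<close> into
      \<open>V - C\<close> and the siblings of \<open>P\<close>.\<close>
    have "decomposable V E k N (V - P)" if dec: "decomposable V E k N (V - C)"
    proof (rule decomposable.split[of "insert (V - C) (Q - {P})" _ X])
      show "\<Union>(insert (V - C) (Q - {P})) = V - P"
      proof -
        have "R \<inter> P = {}" if "R \<in> Q - {P}" for R
          using that P(1) split(2) by (auto simp: pairwise_def disjnt_def)
        then show ?thesis using QV split(1) P(1) by auto
      qed
      show "pairwise disjnt (insert (V - C) (Q - {P}))"
        using split(1,2) by (auto simp: pairwise_def disjnt_def)
      show "covers_cut E X P'" if P': "P' \<in> insert (V - C) (Q - {P})" for P'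
      proof (cases "P' = V - C")
        case True
        show ?thesis unfolding covers_cut_def
        proof (intro allI impI)
          fix x y assume xy: "E x y \<and> x \<in> P' \<and> y \<notin> P'"
          then have "E y x" "y \<in> C" "x \<notin> C" using G True by (auto simp: simple_graph_def)
          then obtain R where "R \<in> Q" "y \<in> R" "x \<notin> R" using split(1) by blast
          then show "x \<in> X \<or> y \<in> X"
            using split(5) \<open>E y x\<close> unfolding covers_cut_def by blast
        qed
      qed (use P' split(5) in auto)
      show "decomposable V E k N P'" if "P' \<in> insert (V - C) (Q - {P})" for P'
        using that dec others by blast
    qed (use split in auto)
    then show ?thesis using imp sub P(1) split(1) by blast
  qed
qed

text \<open>Pushing a decomposition out of a set \<open>F\<close> whose cut is cheapest among the sets between
  \<open>\<alpha>\<close> and \<open>F\<close>: minimum vertex covers of cuts are submodular, so no covering set gets larger.\<close>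

lemma decomposable_push:
  assumes G: "simple_graph V E" and down: "\<And>A B. N A \<Longrightarrow> B \<subseteq> A \<Longrightarrow> N B"
    and Z: "Z \<subseteq> V" "covers_cut E Z F" "\<alpha> \<subseteq> F"
    and min: "\<And>F' Z'. \<alpha> \<subseteq> F' \<Longrightarrow> F' \<subseteq> F \<Longrightarrow> Z' \<subseteq> V \<Longrightarrow> covers_cut E Z' F' \<Longrightarrow> card Z \<le> card Z'"
    and "decomposable V E k N C" and "\<alpha> \<inter> C = {}"
  shows "decomposable V E k N (C - F)"
  using assms(7,8)
proof (induction rule: decomposable.induct)
  case (leaf C)
  then show ?case using down by (blast intro: decomposable.leaf)
next
  case (split Q C X)
  have sym: "\<And>x y. E x y \<Longrightarrow> E y x" and fin: "finite V" using G by (auto simp: simple_graph_def)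
  have cov: "x \<in> X \<or> y \<in> X" if "E x y" "P \<in> Q" "x \<in> P" "y \<notin> P" for x y P
    using split(5) that unfolding covers_cut_def by blast
  have covC: "x \<in> X \<or> y \<in> X" if "E x y" "x \<in> C" "y \<notin> C" for x y
    using cov that split(1) by blast
  have covZ: "x \<in> Z \<or> y \<in> Z" if "E x y" "x \<in> F" "y \<notin> F" for x y
    using Z(2) that unfolding covers_cut_def by blast
  \<comment> \<open>Uncrossing: \<open>X'\<close> covers the cuts of the parts \<open>P - F\<close>,
    \<open>Z'\<close> covers the cut of \<open>F - C\<close>, and their sizes add up to at most
    those of \<open>X\<close> and \<open>Z\<close>. As \<open>F - C\<close> still contains
    \<open>\<alpha>\<close>, \<open>Z'\<close> is no smaller than \<open>Z\<close>, so
    \<open>X'\<close> is no larger than \<open>X\<close>.\<close>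
  define X' where "X' = (X - F) \<union> (Z \<inter> C) \<union> (X \<inter> Z)"
  define Z' where "Z' = (X \<inter> F) \<union> (Z - C) \<union> (X \<inter> Z)"
  have fins: "finite X" "finite Z" "finite X'" "finite Z'"
    using fin split(3) Z(1) by (auto simp: X'_def Z'_def intro: finite_subset)
  have "covers_cut E Z' (F - C)"
    unfolding covers_cut_def Z'_def using covC covZ sym by blast
  then have "card Z \<le> card Z'"
    using min[of "F - C" Z'] Z split(3) split.prems by (auto simp: Z'_def)
  moreover have "card X' + card Z' \<le> card X + card Z"
  proof -
    have "card (X' \<union> Z') \<le> card (X \<union> Z)" "card (X' \<inter> Z') \<le> card (X \<inter> Z)"
      using fins by (auto simp: X'_def Z'_def intro!: card_mono)
    then show ?thesis
      using card_Un_Int[OF fins(1,2)] card_Un_Int[OF fins(3,4)] by linarith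
  qed
  ultimately have card: "card X' \<le> k" using split(4) by linarith
  show ?case
  proof (rule decomposable.split[of "(\<lambda>P. P - F) ` Q" _ X'])
    show "\<Union>((\<lambda>P. P - F) ` Q) = C - F" using split(1) by blast
    show "pairwise disjnt ((\<lambda>P. P - F) ` Q)"
      using split(2) by (fastforce simp: pairwise_def disjnt_def)
    show "X' \<subseteq> V" using split(3) Z(1) by (auto simp: X'_def)
    show "covers_cut E X' P'" if "P' \<in> (\<lambda>P. P - F) ` Q" for P'
    proof -
      from that obtain P where P: "P \<in> Q" "P' = P - F" by blast
      have "x \<in> X' \<or> y \<in> X'" if "E x y" "x \<in> P" "x \<notin> F" "y \<in> F \<or> y \<notin> P" for x y
        using that cov[OF that(1) P(1)] covZ[of y x] sym P(1) split(1) unfolding X'_def by blast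
      then show ?thesis using P(2) unfolding covers_cut_def by blast
    qed
    show "decomposable V E k N P'" if "P' \<in> (\<lambda>P. P - F) ` Q" for P'
      using that split.IH split.prems split(1) by blast
  qed (fact card)
qed

section \<open>Intersecting families that obstruct splittings\<close>

lemma not_decomposable_bramble:
  assumes G: "simple_graph V E" and down: "\<And>A B. N A \<Longrightarrow> B \<subseteq> A \<Longrightarrow> N B"
    and "N {}" and nd: "\<not> decomposable V E k N V"
  obtains \<B> where "\<B> \<subseteq> Pow V" "\<And>A. A \<in> \<B> \<Longrightarrow> \<not> N A"
    "\<And>A B. A \<in> \<B> \<Longrightarrow> B \<in> \<B> \<Longrightarrow> A \<inter> B \<noteq> {}" "\<not> decomposable V E k (\<lambda>A. A \<notin> \<B>) V"
proof -
  have fin: "finite V" using G by (auto simp: simple_graph_def)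
  define good where "good \<B> \<longleftrightarrow> \<B> \<subseteq> Pow V \<and> (\<forall>A\<in>\<B>. \<not> N A)
    \<and> (\<forall>A B. A \<in> \<B> \<and> A \<subseteq> B \<and> B \<subseteq> V \<longrightarrow> B \<in> \<B>) \<and> \<not> decomposable V E k (\<lambda>A. A \<notin> \<B>) V" for \<B>
  have "good {A. A \<subseteq> V \<and> \<not> N A}"
    unfolding good_def using down nd decomposable_mono[of V E k _ V N] by (auto; blast)
  then obtain \<B> where B: "good \<B>" and least: "\<And>\<C>. good \<C> \<Longrightarrow> card \<B> \<le> card \<C>"
    using ex_has_least_nat[of good _ card] by blast
  have BV: "\<B> \<subseteq> Pow V" and BN: "\<And>A. A \<in> \<B> \<Longrightarrow> \<not> N A"
    and up: "\<And>A B. A \<in> \<B> \<Longrightarrow> A \<subseteq> B \<Longrightarrow> B \<subseteq> V \<Longrightarrow> B \<in> \<B>"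
    and ndB: "\<not> decomposable V E k (\<lambda>A. A \<notin> \<B>) V"
    using B unfolding good_def by blast+
  have finB: "finite \<B>" using BV fin by (meson finite_Pow_iff finite_subset)
  have empty: "{} \<notin> \<B>" using BN \<open>N {}\<close> by blast
  \<comment> \<open>Removing the minimal member \<open>\<alpha>\<close> keeps the family upward
    closed, so by least cardinality \<open>V\<close> decomposes with \<open>\<alpha>\<close> as an
    extra leaf. Rerooting starts from \<open>V - V\<close>, a leaf because \<open>{}\<close> is not
    in \<open>\<B>\<close>.\<close>
  have complement: "decomposable V E k (\<lambda>A. A \<notin> \<B>) (V - \<alpha>)"
    if \<alpha>: "\<alpha> \<in> \<B>" and min: "\<And>A. A \<in> \<B> \<Longrightarrow> A \<subseteq> \<alpha> \<Longrightarrow> A = \<alpha>" for \<alpha>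
  proof -
    have "card (\<B> - {\<alpha>}) < card \<B>" using finB \<alpha> by (rule card_Diff1_less)
    then have "\<not> good (\<B> - {\<alpha>})" using least by (meson not_le)
    then have "decomposable V E k (\<lambda>A. A \<notin> \<B> - {\<alpha>}) V"
      using BV BN up min unfolding good_def by blast
    moreover have "(\<lambda>A. A \<notin> \<B> - {\<alpha>}) = (\<lambda>A. A \<notin> \<B> \<or> A = \<alpha>)" by auto
    ultimately have "decomposable V E k (\<lambda>A. A \<notin> \<B> \<or> A = \<alpha>) V" by simp
    from decomposable_reroot[OF G _ this]
    have "decomposable V E k (\<lambda>A. A \<notin> \<B>) (V - V) \<longrightarrow> decomposable V E k (\<lambda>A. A \<notin> \<B>) (V - \<alpha>)"
      using empty \<alpha> ndB by blast
    moreover have "decomposable V E k (\<lambda>A. A \<notin> \<B>) (V - V)"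
      using empty by (auto intro: decomposable.leaf)
    ultimately show ?thesis by blast
  qed
  have "A \<inter> B \<noteq> {}" if AB: "A \<in> \<B>" "B \<in> \<B>" for A B
  proof
    assume disj: "A \<inter> B = {}"
    obtain \<alpha> where \<alpha>: "\<alpha> \<in> \<B>" "\<alpha> \<subseteq> A" "\<And>A. A \<in> \<B> \<Longrightarrow> A \<subseteq> \<alpha> \<Longrightarrow> A = \<alpha>"
      using finite_has_minimal2[OF finB AB(1)] by metis
    obtain \<beta> where \<beta>: "\<beta> \<in> \<B>" "\<beta> \<subseteq> B" "\<And>A. A \<in> \<B> \<Longrightarrow> A \<subseteq> \<beta> \<Longrightarrow> A = \<beta>"
      using finite_has_minimal2[OF finB AB(2)] by metis
    have dis: "\<alpha> \<inter> \<beta> = {}" using disj \<alpha>(2) \<beta>(2) by blast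
    have sub: "\<alpha> \<subseteq> V" "\<beta> \<subseteq> V" using \<alpha>(1) \<beta>(1) BV by auto
    have compl: "covers_cut E Z (V - F)" if "covers_cut E Z F" for Z F
      using that G unfolding covers_cut_def simple_graph_def by blast
    note d\<alpha> = complement[OF \<alpha>(1,3)] and d\<beta> = complement[OF \<beta>(1,3)]
    \<comment> \<open>\<open>V - \<alpha>\<close> contains \<open>\<beta>\<close>, so it is no leaf.
      The covering set at its root bounds the cheapest cut chosen below by \<open>k\<close>.\<close>
    have big: "V - \<alpha> \<in> \<B>" using dis sub by (intro up[OF \<beta>(1)]) auto
    from d\<alpha> obtain X where X: "X \<subseteq> V" "card X \<le> k" "covers_cut E X \<alpha>"
    proof -
      obtain X where "X \<subseteq> V" "card X \<le> k" "covers_cut E X (V - \<alpha>)"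
        using decomposable_cover[OF d\<alpha>] big by blast
      moreover from compl[OF this(3)] sub(1) have "covers_cut E X \<alpha>" by (simp add: double_diff)
      ultimately show ?thesis using that by blast
    qed
    \<comment> \<open>Pairs of a side containing \<open>\<alpha>\<close> and missing
      \<open>\<beta>\<close>, and a cover of its cut. A cheapest pair can be pushed against from
      either side.\<close>
    define cut where "cut p \<longleftrightarrow> \<alpha> \<subseteq> fst p \<and> fst p \<subseteq> V - \<beta> \<and> snd p \<subseteq> V \<and> covers_cut E (snd p) (fst p)" for p
    have "cut (\<alpha>, X)" using X dis sub by (auto simp: cut_def)
    then obtain p where p: "cut p" "\<And>q. cut q \<Longrightarrow> card (snd p) \<le> card (snd q)"
      using ex_has_least_nat[of cut "(\<alpha>, X)" "\<lambda>p. card (snd p)"] by blast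
    obtain F Z where "p = (F, Z)" by (cases p)
    then have FZ: "\<alpha> \<subseteq> F" "F \<subseteq> V - \<beta>" "Z \<subseteq> V" "covers_cut E Z F" using p(1) by (auto simp: cut_def)
    have min: "card Z \<le> card Z'"
      if "\<alpha> \<subseteq> F'" "F' \<subseteq> V - \<beta>" "Z' \<subseteq> V" "covers_cut E Z' F'" for F' Z'
      using p(2)[of "(F', Z')"] that \<open>p = (F, Z)\<close> by (simp add: cut_def)
    \<comment> \<open>Unlike \<open>A \<notin> \<B>\<close>, this agreeing predicate is hereditary also on sets not contained in \<open>V\<close>.\<close>
    let ?N = "\<lambda>A. \<not> (\<exists>B\<in>\<B>. B \<subseteq> A)"
    have down': "?N B" if "?N A" "B \<subseteq> A" for A B using that by blast
    have conv: "decomposable V E k ?N C \<longleftrightarrow> decomposable V E k (\<lambda>A. A \<notin> \<B>) C" for C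
    proof
      assume "decomposable V E k ?N C"
      then show "decomposable V E k (\<lambda>A. A \<notin> \<B>) C"
        by (rule decomposable_mono) blast
    next
      assume "decomposable V E k (\<lambda>A. A \<notin> \<B>) C"
      then show "decomposable V E k ?N C"
        by (rule decomposable_mono) (metis up)
    qed
    have "V - \<alpha> - F = V - F" using FZ(1) by blast
    moreover have "decomposable V E k ?N (V - \<alpha> - F)"
    proof (rule decomposable_push[OF G down' FZ(3,4,1)])
      show "card Z \<le> card Z'"
        if "\<alpha> \<subseteq> F'" "F' \<subseteq> F" "Z' \<subseteq> V" "covers_cut E Z' F'" for F' Z'
        using min[OF that(1) _ that(3,4)] that(2) FZ(2) by simp
    qed (use d\<alpha> conv in auto)
    ultimately have dF: "decomposable V E k ?N (V - F)" by simp
    \<comment> \<open>The mirrored push: the complement of a set between \<open>\<beta>\<close> and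
      \<open>V - F\<close> again separates \<open>\<alpha>\<close> from \<open>\<beta>\<close>, so
      \<open>Z\<close> is cheapest on this side too.\<close>
    have "decomposable V E k ?N ((V - \<beta>) - (V - F))"
    proof (rule decomposable_push[OF G down' FZ(3) compl[OF FZ(4)], where \<alpha> = \<beta>])
      show "card Z \<le> card Z'"
        if "\<beta> \<subseteq> F'" "F' \<subseteq> V - F" "Z' \<subseteq> V" "covers_cut E Z' F'" for F' Z'
        by (rule min[of "V - F'" Z', OF _ _ that(3) compl[OF that(4)]])
          (use that(1,2) FZ(1) sub(1) in auto)
      show "\<beta> \<subseteq> V - F" using FZ(2) sub(2) by auto
      show "decomposable V E k ?N (V - \<beta>)" using d\<beta> conv by simp
    qed auto
    moreover have "(V - \<beta>) - (V - F) = F" using FZ(2) by blast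
    ultimately have dF': "decomposable V E k ?N F" by simp
    have "decomposable V E k ?N V"
    proof (rule decomposable.split[of "{F, V - F}" _ Z])
      have "card Z \<le> card X" by (rule min[OF subset_refl _ X(1,3)]) (use dis sub in auto)
      then show "card Z \<le> k" using X(2) by simp
      show "covers_cut E Z P" if "P \<in> {F, V - F}" for P using that FZ(4) compl by auto
      show "decomposable V E k ?N P" if "P \<in> {F, V - F}" for P using that dF dF' by auto
    qed (use FZ in \<open>auto simp: pairwise_def disjnt_def\<close>)
    then show False using ndB conv by simp
  qed
  then show thesis using that BV BN ndB by blast
qed

section \<open>Thickets\<close>

definition component :: "('a \<Rightarrow> 'a \<Rightarrow> bool) \<Rightarrow> 'a set \<Rightarrow> 'a \<Rightarrow> 'a set" where
  "component E U x = {y. (\<lambda>a b. E a b \<and> a \<in> U \<and> b \<in> U)\<^sup>*\<^sup>* x y}"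

lemma component_subset: "x \<in> U \<Longrightarrow> component E U x \<subseteq> U"
proof
  fix y assume "x \<in> U" "y \<in> component E U x"
  then have "(\<lambda>a b. E a b \<and> a \<in> U \<and> b \<in> U)\<^sup>*\<^sup>* x y" by (simp add: component_def)
  then show "y \<in> U" by (induction rule: rtranclp_induct) (use \<open>x \<in> U\<close> in auto)
qed

text \<open>Paths in \<open>U\<close> from \<open>x\<close> never leave the component, and by
  symmetry any two of its vertices are joined through \<open>x\<close>.\<close>

lemma component_connected:
  assumes sym: "\<And>x y. E x y \<Longrightarrow> E y x"
  shows "induced_connected E (component E U x)"
proof -
  let ?R = "\<lambda>a b. E a b \<and> a \<in> U \<and> b \<in> U"
  let ?C = "component E U x"
  let ?S = "\<lambda>a b. E a b \<and> a \<in> ?C \<and> b \<in> ?C"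
  have reach: "?S\<^sup>*\<^sup>* x y" if "?R\<^sup>*\<^sup>* x y" for y
    using that
  proof (induction rule: rtranclp_induct)
    case (step y z)
    then have "?S y z" by (auto simp: component_def intro: rtranclp.rtrancl_into_rtrancl)
    then show ?case using step.IH by (rule rtranclp.rtrancl_into_rtrancl[rotated])
  qed auto
  have "symp ?S" using sym by (auto simp: symp_def)
  then have "symp ?S\<^sup>*\<^sup>*" by (rule symp_rtranclp)
  then have "?S\<^sup>*\<^sup>* y z" if "y \<in> ?C" "z \<in> ?C" for y z
  proof -
    have "?S\<^sup>*\<^sup>* x y" "?S\<^sup>*\<^sup>* x z" using that by (intro reach, simp add: component_def)+
    then show ?thesis using sympD[OF \<open>symp ?S\<^sup>*\<^sup>*\<close>] by (meson rtranclp_trans)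
  qed
  moreover have "x \<in> ?C" by (simp add: component_def)
  ultimately show ?thesis unfolding induced_connected_def by blast
qed

lemma component_eqI:
  assumes sym: "\<And>x y. E x y \<Longrightarrow> E y x" and "z \<in> component E U x"
  shows "component E U z = component E U x"
proof -
  let ?R = "\<lambda>a b. E a b \<and> a \<in> U \<and> b \<in> U"
  have "symp ?R" using sym by (auto simp: symp_def)
  then have "symp ?R\<^sup>*\<^sup>*" by (rule symp_rtranclp)
  then have "?R\<^sup>*\<^sup>* z x" "?R\<^sup>*\<^sup>* x z" using assms(2) by (auto simp: component_def dest: sympD)
  then show ?thesis unfolding component_def by (auto intro: rtranclp_trans)
qed

text \<open>A path inside \<open>S\<close> could leave \<open>P\<close> only along an edge with an
  end in \<open>X\<close>, and \<open>S\<close> avoids \<open>X\<close>.\<close>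

lemma connected_within_part:
  assumes "induced_connected E S" "covers_cut E X P" "S \<inter> X = {}" "S \<inter> P \<noteq> {}"
  shows "S \<subseteq> P"
proof
  fix y assume "y \<in> S"
  from assms(4) obtain x where x: "x \<in> S" "x \<in> P" by blast
  have "(\<lambda>a b. E a b \<and> a \<in> S \<and> b \<in> S)\<^sup>*\<^sup>* x y"
    using assms(1) x(1) \<open>y \<in> S\<close> unfolding induced_connected_def by blast
  then show "y \<in> P"
    by (induction rule: rtranclp_induct) (use x(2) assms(2,3) in \<open>auto simp: covers_cut_def\<close>)
qed

section \<open>Hitting sizes and the thicket number\<close>

lemma hitting_size_le: "X \<subseteq> V \<Longrightarrow> (\<And>A. A \<in> H \<Longrightarrow> X \<inter> A \<noteq> {}) \<Longrightarrow> hitting_size V H \<le> card X"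
  unfolding hitting_size_def by (rule Least_le) blast

lemma hitting_size_attained:
  assumes "thicket V E H"
  obtains X where "X \<subseteq> V" "card X = hitting_size V H" "\<And>A. A \<in> H \<Longrightarrow> X \<inter> A \<noteq> {}"
proof -
  let ?P = "\<lambda>k. \<exists>X. X \<subseteq> V \<and> card X = k \<and> (\<forall>A\<in>H. X \<inter> A \<noteq> {})"
  have "?P (card V)" using assms by (intro exI[of _ V]) (auto simp: thicket_def)
  then have "?P (hitting_size V H)" unfolding hitting_size_def by (rule LeastI)
  then show thesis using that by blast
qed

text \<open>A thicket is a subset of \<open>Pow V\<close>. Finiteness is what makes the
  \<open>Max\<close> in \<open>thicket_number\<close> an actual maximum.\<close>

lemma finite_hitting_sizes:
  assumes "finite V" shows "finite {hitting_size V H | H. thicket V E H}"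
proof (rule finite_subset)
  show "{hitting_size V H | H. thicket V E H} \<subseteq> hitting_size V ` Pow (Pow V)"
    by (auto simp: thicket_def)
qed (use assms in simp)

lemma hitting_size_le_thicket_number:
  "finite V \<Longrightarrow> thicket V E H \<Longrightarrow> hitting_size V H \<le> thicket_number V E"
  unfolding thicket_number_def by (rule Max_ge[OF finite_hitting_sizes]) auto

lemma thicket_number_attained:
  assumes "finite V"
  obtains H where "thicket V E H" "hitting_size V H = thicket_number V E"
proof -
  have "thicket V E {}" by (simp add: thicket_def)
  then have "{hitting_size V H | H. thicket V E H} \<noteq> {}" by blast
  from Max_in[OF finite_hitting_sizes[OF assms] this] show thesis
    using that unfolding thicket_number_def by fastforce
qed

text \<open>A single vertex forms a thicket that the empty set does not hit.\<close>

lemma thicket_number_pos: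
  assumes "finite V" "V \<noteq> {}"
  shows "thicket_number V E \<ge> 1"
proof -
  obtain a where a: "a \<in> V" using assms by blast
  have H: "thicket V E {{a}}" using a by (auto simp: thicket_def induced_connected_def)
  obtain X where X: "X \<subseteq> V" "card X = hitting_size V {{a}}" "\<And>A. A \<in> {{a}} \<Longrightarrow> X \<inter> A \<noteq> {}"
    by (rule hitting_size_attained[OF H]) blast
  then have "X \<noteq> {}" by auto
  then have "card X \<ge> 1"
    using finite_subset[OF X(1) assms(1)] by (simp only: Suc_le_eq One_nat_def card_gt_0_iff) simp
  then show ?thesis using X(2) hitting_size_le_thicket_number[OF assms(1) H] by simp
qed

text \<open>Otherwise the connected members of the intersecting family form a thicket, hit by some
  \<open>X\<close> of at most \<open>thicket_number V E\<close> vertices. Then \<open>X\<close>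
  splits \<open>V\<close> into leaves: components of \<open>V - X\<close> are connected and missed
  by \<open>X\<close>, hence outside the family, and singletons are small.\<close>

lemma decomposable_thicket_number:
  assumes G: "simple_graph V E" and down: "\<And>A B. N A \<Longrightarrow> B \<subseteq> A \<Longrightarrow> N B"
    and single: "\<And>x. N {x}"
  shows "decomposable V E (thicket_number V E) N V"
proof (rule ccontr)
  let ?k = "thicket_number V E"
  assume nd: "\<not> decomposable V E ?k N V"
  have "N {}" using down[OF single] by simp
  obtain \<B> where B: "\<B> \<subseteq> Pow V" "\<And>A. A \<in> \<B> \<Longrightarrow> \<not> N A"
    "\<And>A B. A \<in> \<B> \<Longrightarrow> B \<in> \<B> \<Longrightarrow> A \<inter> B \<noteq> {}" "\<not> decomposable V E ?k (\<lambda>A. A \<notin> \<B>) V"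
    by (rule not_decomposable_bramble[OF G _ \<open>N {}\<close> nd]) (use down in blast)+
  have fin: "finite V" and sym: "\<And>x y. E x y \<Longrightarrow> E y x" and EV: "\<And>x y. E x y \<Longrightarrow> y \<in> V"
    using G by (auto simp: simple_graph_def)
  define H where "H = {A \<in> \<B>. induced_connected E A}"
  have H: "thicket V E H"
  proof -
    have "finite H" using B(1) fin unfolding H_def by (auto intro: finite_subset[of _ "Pow V"])
    then show ?thesis using B(1,3) unfolding thicket_def H_def by (auto simp: induced_connected_def)
  qed
  obtain X where X: "X \<subseteq> V" "card X = hitting_size V H" "\<And>A. A \<in> H \<Longrightarrow> X \<inter> A \<noteq> {}"
    using hitting_size_attained[OF H] by blast
  define U where "U = V - X"
  define Q where "Q = (\<lambda>x. {x}) ` X \<union> component E U ` U"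
  have self: "x \<in> component E U x" for x by (simp add: component_def)
  have sub: "component E U x \<subseteq> U" if "x \<in> U" for x using component_subset that by metis
  have "decomposable V E ?k (\<lambda>A. A \<notin> \<B>) V"
  proof (rule decomposable.split[of Q _ X])
    show "\<Union>Q = V"
      using self sub X(1) unfolding Q_def U_def by fastforce
    have "disjnt (component E U x) (component E U y)"
      if "component E U x \<noteq> component E U y" for x y
      using that component_eqI[of E _ U, OF sym] unfolding disjnt_def by blast
    then show "pairwise disjnt Q"
      using sub unfolding Q_def pairwise_def disjnt_def U_def by blast
    show "card X \<le> ?k" using X(2) hitting_size_le_thicket_number[OF fin H] by simp
    show "covers_cut E X P" if "P \<in> Q" for P
      using that unfolding Q_def
    proof
      assume "P \<in> component E U ` U"
      then obtain z where z: "z \<in> U" "P = component E U z" by blast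
      show ?thesis unfolding covers_cut_def
      proof (intro allI impI)
        fix x y assume xy: "E x y \<and> x \<in> P \<and> y \<notin> P"
        then have "x \<in> U" using sub z by blast
        moreover have "y \<notin> U"
          using xy z \<open>x \<in> U\<close> unfolding component_def
          by (auto dest: rtranclp.rtrancl_into_rtrancl)
        ultimately show "x \<in> X \<or> y \<in> X" using EV xy unfolding U_def by blast
      qed
    qed (auto simp: covers_cut_def)
    show "decomposable V E ?k (\<lambda>A. A \<notin> \<B>) P" if "P \<in> Q" for P
    proof (rule decomposable.leaf)
      show "P \<subseteq> V" using \<open>\<Union>Q = V\<close> that by blast
      show "P \<notin> \<B>"
        using that unfolding Q_def
      proof
        assume "P \<in> component E U ` U"
        then obtain z where z: "z \<in> U" "P = component E U z" by blast
        then have "X \<inter> P = {}" using sub unfolding U_def by blast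
        then show ?thesis using X(3)[of P] component_connected[of E U z] sym z(2) unfolding H_def by blast
      next
        assume "P \<in> (\<lambda>x. {x}) ` X"
        then show ?thesis using B(2) single by fastforce
      qed
    qed
  qed (fact X(1))
  then show False using B(4) by blast
qed

section \<open>Packing and covering\<close>

text \<open>Descend to a lowest set containing a member of \<open>F\<close>. A connected member that
  avoids \<open>X\<close> and meets this set would lie inside one of its parts, and no part contains
  a member.\<close>

lemma decomposable_hitting:
  assumes "decomposable V E k (\<lambda>A. (\<exists>a. A \<subseteq> {a}) \<or> (\<forall>S\<in>F. \<not> S \<subseteq> A)) C"
    and "k \<ge> 1" and conn: "\<And>S. S \<in> F \<Longrightarrow> induced_connected E S"
    and "\<exists>S\<in>F. S \<subseteq> C"
  shows "\<exists>X S0. X \<subseteq> V \<and> card X \<le> k \<and> S0 \<in> F \<and> (\<forall>S\<in>F. S \<inter> X = {} \<longrightarrow> S \<inter> S0 = {})"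
  using assms(1,4)
proof (induction rule: decomposable.induct)
  \<comment> \<open>A leaf containing a member has at most one vertex; the member serves as both
    \<open>X\<close> and \<open>S0\<close>, which takes \<open>k \<ge> 1\<close>.\<close>
  case (leaf C)
  then obtain S where S: "S \<in> F" "S \<subseteq> C" by blast
  then obtain a where "C \<subseteq> {a}" using leaf by blast
  then have "card S \<le> card {a}" using S(2) by (intro card_mono) auto
  then have "card S \<le> k" using assms(2) by simp
  then show ?case using S leaf(2) by (intro exI[of _ S]) auto
next
  case (split Q C X)
  show ?case
  proof (cases "\<exists>P\<in>Q. \<exists>S\<in>F. S \<subseteq> P")
    case True
    then show ?thesis using split.IH by blast
  next
    case False
    from split.prems obtain S0 where S0: "S0 \<in> F" "S0 \<subseteq> C" by blast
    have "S \<inter> S0 = {}" if S: "S \<in> F" "S \<inter> X = {}" for S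
    proof (rule ccontr)
      assume "S \<inter> S0 \<noteq> {}"
      then obtain P where "P \<in> Q" "S \<inter> P \<noteq> {}" using S0(2) split(1) by blast
      then have "S \<subseteq> P" using connected_within_part[OF conn[OF S(1)] split(5) S(2)] by metis
      then show False using False S(1) \<open>P \<in> Q\<close> by blast
    qed
    then show ?thesis using split(3,4) S0(1) by blast
  qed
qed

text \<open>Induction on the packing bound \<open>r\<close>: charging \<open>1\<close> to each
  vertex of \<open>X\<close> lowers it by one at cost at most \<open>thicket_number V E\<close>. The
  residual valuation may vanish identically, so the statement does not ask for
  \<open>coalition_game\<close>.\<close>

lemma cover_from_packing:
  fixes v :: "'a set \<Rightarrow> nat"
  assumes G: "simple_graph V E" and "V \<noteq> {}"
    and "\<And>S. S \<subseteq> V \<Longrightarrow> v S \<noteq> 0 \<Longrightarrow> induced_connected E S"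
    and "\<And>F. F \<subseteq> Pow V \<Longrightarrow> pairwise disjnt F \<Longrightarrow> sum v F \<le> r"
  shows "\<exists>x :: 'a \<Rightarrow> nat. (\<forall>S. S \<subseteq> V \<longrightarrow> v S \<le> sum x S) \<and> sum x V \<le> thicket_number V E * r"
  using assms(3,4)
proof (induction r arbitrary: v)
  case 0
  have "v S = 0" if "S \<subseteq> V" for S using "0.prems"(2)[of "{S}"] that by simp
  then show ?case by (intro exI[of _ "\<lambda>_. 0"]) simp
next
  case (Suc r)
  let ?k = "thicket_number V E"
  have fin: "finite V" using G by (simp add: simple_graph_def)
  define F where "F = {S. S \<subseteq> V \<and> v S \<noteq> 0}"
  show ?case
  proof (cases "F = {}")
    case True
    then show ?thesis by (intro exI[of _ "\<lambda>_. 0"]) (auto simp: F_def)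
  next
    case False
    have conn: "induced_connected E S" if "S \<in> F" for S using that Suc.prems(1) by (simp add: F_def)
    have sub: "\<exists>S\<in>F. S \<subseteq> V" using False by (auto simp: F_def)
    have dec: "decomposable V E ?k (\<lambda>A. (\<exists>a. A \<subseteq> {a}) \<or> (\<forall>S\<in>F. \<not> S \<subseteq> A)) V"
      by (rule decomposable_thicket_number[OF G]) blast+
    obtain X S0 where X: "X \<subseteq> V" "card X \<le> ?k" "S0 \<in> F"
      and avoid: "\<And>S. S \<in> F \<Longrightarrow> S \<inter> X = {} \<Longrightarrow> S \<inter> S0 = {}"
      using decomposable_hitting[OF dec thicket_number_pos[OF fin \<open>V \<noteq> {}\<close>] conn sub] by metis
    define w where "w S = v S - card (S \<inter> X)" for S
    have finX: "finite X" using X(1) fin by (rule finite_subset)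
    have "sum w P \<le> r" if P: "P \<subseteq> Pow V" "pairwise disjnt P" for P
    proof -
      \<comment> \<open>Members with \<open>w S = 0\<close> contribute nothing but might meet
        \<open>S0\<close>, so they are dropped before \<open>S0\<close> is added.\<close>
      define P' where "P' = {S \<in> P. w S \<noteq> 0}"
      have finP: "finite P" using P(1) fin by (meson finite_Pow_iff finite_subset)
      then have finP': "finite P'" by (simp add: P'_def)
      have P'V: "P' \<subseteq> Pow V" and disj: "pairwise disjnt P'"
        using P by (auto simp: P'_def pairwise_def)
      have sum: "sum w P = sum w P'"
        by (rule sum.mono_neutral_right) (use finP in \<open>auto simp: P'_def\<close>)
      have P'F: "P' \<subseteq> F" using P(1) by (auto simp: P'_def F_def w_def)
      have le: "w S \<le> v S" for S by (simp add: w_def)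
      show ?thesis
      \<comment> \<open>Either \<open>X\<close> charges some member, and the sum falls strictly
        below that of \<open>v\<close>, or all members avoid \<open>X\<close>, and adding
        \<open>S0\<close> gives a packing worth at least one more.\<close>
      proof (cases "\<exists>S\<in>P'. S \<inter> X \<noteq> {}")
        case True
        then obtain S where S: "S \<in> P'" "S \<inter> X \<noteq> {}" by blast
        then have "card (S \<inter> X) > 0" using finX by (simp add: card_gt_0_iff)
        then have "w S < v S" using S(1) by (auto simp: P'_def w_def)
        then have "sum w P' < sum v P'"
          using S(1) le finP' by (intro sum_strict_mono_ex1) auto
        then show ?thesis using sum Suc.prems(2)[OF P'V disj] by linarith
      next
        case False
        then have away: "S \<inter> S0 = {}" if "S \<in> P'" for S
          using avoid[of S] P'F that by auto
        have S0: "S0 \<subseteq> V" "v S0 > 0" "S0 \<noteq> {}"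
          using X(3) conn[OF X(3)] by (auto simp: F_def induced_connected_def)
        then have "S0 \<notin> P'" using away by blast
        moreover have "pairwise disjnt (insert S0 P')"
          using disj away by (auto simp: pairwise_insert disjnt_def)
        then have "sum v (insert S0 P') \<le> Suc r" using Suc.prems(2) P'V S0(1) by simp
        ultimately have "sum v P' \<le> r" using finP' S0(2) by simp
        then show ?thesis using sum sum_mono[of P' w v] le by force
      qed
    qed
    moreover have "induced_connected E S" if "S \<subseteq> V" "w S \<noteq> 0" for S
      using that Suc.prems(1) by (simp add: w_def)
    ultimately obtain y :: "'a \<Rightarrow> nat" where y: "\<And>S. S \<subseteq> V \<Longrightarrow> w S \<le> sum y S" "sum y V \<le> ?k * r"
      using Suc.IH[of w] by blast
    define x where "x i = y i + (if i \<in> X then 1 else 0)" for i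
    have sx: "sum x S = sum y S + card (S \<inter> X)" if "S \<subseteq> V" for S
      using finite_subset[OF that fin] by (simp add: x_def sum.distrib sum.If_cases)
    have "v S \<le> sum x S" if "S \<subseteq> V" for S
      using y(1)[OF that] sx[OF that] by (simp add: w_def)
    moreover have "sum x V \<le> ?k * Suc r"
      using sx[of V] y(2) X(1,2) by (simp add: Int_absorb1)
    ultimately show ?thesis by blast
  qed
qed

section \<open>Attainment of the packing and covering numbers\<close>

lemma finite_packing_values:
  "finite V \<Longrightarrow> finite {(\<Sum>S\<in>F. v S) | F. F \<subseteq> Pow V \<and> pairwise disjnt F}"
  by (rule finite_subset[of _ "sum v ` Pow (Pow V)"]) auto

lemma sum_le_rho:
  "finite V \<Longrightarrow> F \<subseteq> Pow V \<Longrightarrow> pairwise disjnt F \<Longrightarrow> sum v F \<le> rho V v"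
  unfolding rho_def by (rule Max_ge[OF finite_packing_values]) auto

lemma rho_le:
  assumes "finite V" "\<And>F. F \<subseteq> Pow V \<Longrightarrow> pairwise disjnt F \<Longrightarrow> sum v F \<le> r"
  shows "rho V v \<le> r"
proof -
  have "{(\<Sum>S\<in>F. v S) | F. F \<subseteq> Pow V \<and> pairwise disjnt F} \<noteq> {}"
    by (auto intro!: exI[of _ "{}"])
  then show ?thesis
    unfolding rho_def using Max_le_iff[OF finite_packing_values[OF assms(1)]] assms(2) by blast
qed

lemma rho_pos:
  assumes "finite V" "coalition_game V E v"
  shows "rho V v > 0"
proof -
  obtain S where S: "S \<subseteq> V" "v S \<noteq> 0" using assms(2) by (auto simp: coalition_game_def)
  then show ?thesis using sum_le_rho[OF assms(1), of "{S}" v] by simp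
qed

lemma kappa_attained:
  assumes "finite V" "v {} = 0"
  obtains x :: "'a \<Rightarrow> nat" where "\<And>S. S \<subseteq> V \<Longrightarrow> v S \<le> sum x S" "sum x V = kappa V v"
proof -
  let ?P = "\<lambda>k. \<exists>x :: 'a \<Rightarrow> nat. (\<forall>S. S \<subseteq> V \<longrightarrow> v S \<le> sum x S) \<and> sum x V = k"
  \<comment> \<open>A constant so large that a single vertex pays for any coalition; the empty set
    relies on \<open>v {} = 0\<close>.\<close>
  let ?x = "\<lambda>_ :: 'a. sum v (Pow V)"
  have "v S \<le> sum ?x S" if "S \<subseteq> V" for S
  proof (cases "S = {}")
    case False
    then have "card S \<ge> 1" using finite_subset[OF that assms(1)] by (simp add: Suc_le_eq card_gt_0_iff)
    then have "sum v (Pow V) \<le> sum ?x S" by auto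
    moreover have "v S \<le> sum v (Pow V)" using that assms(1) by (intro member_le_sum) auto
    ultimately show ?thesis by (rule order_trans[rotated])
  qed (use assms(2) in simp)
  then have "?P (sum ?x V)" by blast
  then have "?P (kappa V v)" unfolding kappa_def by (rule LeastI)
  then show thesis using that by blast
qed

lemma kappa_le:
  "(\<And>S. S \<subseteq> V \<Longrightarrow> v S \<le> sum x S) \<Longrightarrow> kappa V v \<le> sum x V"
  unfolding kappa_def by (rule Least_le) blast

text \<open>A disjoint family contains at most one member of \<open>H\<close>, and nonemptiness of
  \<open>H\<close> keeps the valuation from vanishing.\<close>

lemma thicket_game:
  assumes fin: "finite V" and H: "thicket V E H" "H \<noteq> {}"
  defines "v \<equiv> \<lambda>S. if S \<in> H then 1 else 0 :: nat"
  shows "coalition_game V E v" "rho V v = 1" "hitting_size V H \<le> kappa V v"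
proof -
  have mem: "A \<subseteq> V" "A \<noteq> {}" "induced_connected E A" if "A \<in> H" for A
    using H(1) that by (auto simp: thicket_def)
  show game: "coalition_game V E v"
    using H(2) mem unfolding coalition_game_def v_def by auto
  have "sum v F \<le> 1" if F: "F \<subseteq> Pow V" "pairwise disjnt F" for F
  proof -
    have finF: "finite F" using F(1) fin by (meson finite_Pow_iff finite_subset)
    have "A = B" if "A \<in> F \<inter> H" "B \<in> F \<inter> H" for A B
    proof -
      have "A \<inter> B \<noteq> {}" using that H(1) by (simp add: thicket_def)
      then show ?thesis using that F(2) by (auto simp: pairwise_def disjnt_def)
    qed
    then have "card (F \<inter> H) \<le> 1" using finF by (auto simp: card_le_Suc0_iff_eq)
    then show ?thesis using finF by (simp add: v_def sum.If_cases)
  qed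
  then have "rho V v \<le> 1" by (rule rho_le[OF fin])
  then show "rho V v = 1" using rho_pos[OF fin game] by linarith
  have "v {} = 0" using mem(2) by (auto simp: v_def)
  then obtain x :: "'a \<Rightarrow> nat" where x: "\<And>S. S \<subseteq> V \<Longrightarrow> v S \<le> sum x S" "sum x V = kappa V v"
    using kappa_attained[OF fin] by blast
  \<comment> \<open>An integral cover is at least \<open>1\<close> on its support, so the support
    has at most \<open>sum x V\<close> vertices.\<close>
  define X where "X = {i \<in> V. x i \<noteq> 0}"
  have "X \<inter> A \<noteq> {}" if "A \<in> H" for A
  proof
    assume "X \<inter> A = {}"
    then have "sum x A = 0" using mem(1)[OF that] by (intro sum.neutral) (auto simp: X_def)
    then show False using x(1)[OF mem(1)[OF that]] that by (simp add: v_def)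
  qed
  then have "hitting_size V H \<le> card X" by (intro hitting_size_le) (auto simp: X_def)
  also have "\<dots> = (\<Sum>i\<in>X. 1)" by simp
  also have "\<dots> \<le> sum x X" by (intro sum_mono) (auto simp: X_def)
  also have "\<dots> \<le> sum x V" by (intro sum_mono2) (use fin in \<open>auto simp: X_def\<close>)
  finally show "hitting_size V H \<le> kappa V v" using x(2) by simp
qed

theorem theorem1:
  fixes V :: "'a set" and E :: "'a \<Rightarrow> 'a \<Rightarrow> bool"
  assumes "simple_graph V E" and "V \<noteq> {}"
  shows "(\<forall>v. coalition_game V E v \<longrightarrow>
            real (kappa V v) / real (rho V v) \<le> real (thicket_number V E))
       \<and> (\<exists>v. coalition_game V E v \<and>
            real (kappa V v) / real (rho V v) \<ge> real (thicket_number V E))"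
proof (intro conjI allI impI)
  have fin: "finite V" using assms(1) by (simp add: simple_graph_def)
  fix v assume v: "coalition_game V E v"
  have "\<exists>x :: 'a \<Rightarrow> nat. (\<forall>S. S \<subseteq> V \<longrightarrow> v S \<le> sum x S) \<and> sum x V \<le> thicket_number V E * rho V v"
  proof (rule cover_from_packing[OF assms])
    show "induced_connected E S" if "S \<subseteq> V" "v S \<noteq> 0" for S
      using v that by (auto simp: coalition_game_def)
  qed (rule sum_le_rho[OF fin])
  then obtain x :: "'a \<Rightarrow> nat" where x: "\<And>S. S \<subseteq> V \<Longrightarrow> v S \<le> sum x S"
      "sum x V \<le> thicket_number V E * rho V v" by blast
  have "kappa V v \<le> sum x V" using x(1) by (rule kappa_le)
  also note x(2)
  finally have "kappa V v \<le> thicket_number V E * rho V v" .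
  then have "real (kappa V v) \<le> real (thicket_number V E) * real (rho V v)"
    by (metis of_nat_le_iff of_nat_mult)
  then show "real (kappa V v) / real (rho V v) \<le> real (thicket_number V E)"
    using rho_pos[OF fin v] by (simp add: divide_le_eq)
next
  have fin: "finite V" using assms(1) by (simp add: simple_graph_def)
  obtain H where H: "thicket V E H" "hitting_size V H = thicket_number V E"
    by (rule thicket_number_attained[OF fin])
  \<comment> \<open>The empty thicket has hitting size \<open>0\<close>, whereas the thicket number
    is positive.\<close>
  have "H \<noteq> {}"
    using H(2) thicket_number_pos[OF fin assms(2), of E] hitting_size_le[of "{}" V H] by auto
  show "\<exists>v. coalition_game V E v \<and>
            real (kappa V v) / real (rho V v) \<ge> real (thicket_number V E)"
    using thicket_game[OF fin H(1) \<open>H \<noteq> {}\<close>] H(2) by (intro exI conjI) auto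
qed

end
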